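(* Consider the symmetric rendezvous search game on $K_3$, with meeting step $T$, in which both players independently use the same strategy. For every integer $k\ge 1$, the Anderson--Weber strategy minimizes $E[\min\{T,k+1\}]=\sum_{i=0}^{k}P(T>i)$ over all strategies, and the minimum value is $$w_k=\begin{cases}\tfrac52-\tfrac52\,3^{-\frac{k+1}{2}}, & \text{when } k \text{ is odd},\\[4pt] \tfrac52-\tfrac32\,3^{-\frac{k}{2}}, & \text{when } k \text{ is even}.\end{cases}$$ Consequently, the Anderson--Weber strategy is optimal for the game (it minimizes $ET$ over all strategies), and the minimal achievable value of $ET$ is $w=\tfrac52$.
   Context: The symmetric rendezvous search game on $K_3$ (the complete graph on three vertices, called locations): two players are initially placed at two distinct locations. The game is played in discrete steps $1,2,\ldots$; at each step each player either stays where he is or moves to another location. The players cannot observe one another and have no common labelling of the locations, so at each step a player chooses the probabilities of moving to each location only as a function of where he has been at previous steps. Both players must use an identical strategy, with independent randomization. They wish to meet as quickly as possible. They meet at a step if they are at the same location after the moves of that step, and $T\in\{1,2,\ldots\}\cup\{\infty\}$ denotes the number of the step on which they first meet. The locations are arranged on a circle and the players have a common notion of clockwise. Precisely: identify the locations with $\mathbb{Z}/3\mathbb{Z}$, with adding $1$ meaning one position clockwise. Player I starts at $a$ and player II starts at $a+d$, where $d$ is uniformly random in $\{1,2\}$ (and unknown to the players). A strategy is a probability distribution on sequences $(i_1,i_2,\ldots)\in\{0,1,2\}^{\{1,2,\ldots\}}$, where $i_t$ is the number of positions clockwise from the player's own initial location at which he is located at step $t$. The two players draw their sequences $(i_t)$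 and $(j_t)$ independently of each other and of $d$ from this same distribution, and $T=\min\{t\ge 1: a+i_t\equiv a+d+j_t \pmod 3\}$ (with $T=\infty$ if there is no such $t$). The Anderson--Weber strategy on $K_3$: in each successive block of two consecutive steps (steps $1,2$; steps $3,4$; and so on), each player, independently of the other player and of previous blocks, with probability $\tfrac13$ stays at his initial location for both steps of the block, and with probability $\tfrac23$ tours the other two locations, visiting them one per step in uniformly random order. That is, the pairs $(i_{2m-1},i_{2m})$, $m\ge1$, are independent and identically distributed, each taking the values $(0,0)$, $(1,2)$, $(2,1)$ with probability $\tfrac13$ each. $w_k$ denotes the minimum achievable value of $E[\min\{T,k+1\}]$, and $w$ the minimum achievable value of $ET$, over all strategies. *)

theory Defs
  imports "HOL-Probability.Probability" "HOL-Number_Theory.Cong"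
begin

text \<open>Locations are integers modulo 3, and adding 1 is one position clockwise. A path gives, for
  each step \<open>t \<ge> 1\<close>, the number of positions clockwise from the player's own initial location.\<close>

definition path_space :: "(nat \<Rightarrow> int) measure" where
  "path_space = PiM {1..} (\<lambda>_. count_space {0, 1, 2})"

definition strategies :: "(nat \<Rightarrow> int) measure set" where
  "strategies = {P. prob_space P \<and> sets P = sets path_space}"

text \<open>An outcome \<open>(i, j, d)\<close> consists of the independently drawn paths of players I and II and the
  displacement of player II's initial location from that of player I.\<close>

definition game :: "(nat \<Rightarrow> int) measure \<Rightarrow> ((nat \<Rightarrow> int) \<times> (nat \<Rightarrow> int) \<times> int) measure" where
  "game P = P \<Otimes>\<^sub>M P \<Otimes>\<^sub>M uniform_count_measure {1, 2}"

text \<open>The infimum of the empty set in \<^typ>\<open>enat\<close> is \<open>\<infinity>\<close>, so players who never meet have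
  \<open>T = \<infinity>\<close>. The parameter \<open>a\<close> is the initial location of player I.\<close>

definition meeting_step :: "int \<Rightarrow> (nat \<Rightarrow> int) \<times> (nat \<Rightarrow> int) \<times> int \<Rightarrow> enat" where
  "meeting_step a = (\<lambda>(i, j, d). INF t \<in> {t. t \<ge> 1 \<and> [a + i t = a + d + j t] (mod 3)}. enat t)"

definition expected_step :: "int \<Rightarrow> (nat \<Rightarrow> int) measure \<Rightarrow> ennreal" where
  "expected_step a P = (\<integral>\<^sup>+ \<omega>. ennreal_of_enat (meeting_step a \<omega>) \<partial>game P)"

definition expected_truncated_step :: "int \<Rightarrow> nat \<Rightarrow> (nat \<Rightarrow> int) measure \<Rightarrow> ennreal" where
  "expected_truncated_step a k P =
     (\<integral>\<^sup>+ \<omega>. ennreal_of_enat (min (meeting_step a \<omega>) (enat (k + 1))) \<partial>game P)"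

definition w_trunc :: "int \<Rightarrow> nat \<Rightarrow> ennreal" where
  "w_trunc a k = (INF P \<in> strategies. expected_truncated_step a k P)"

definition w_full :: "int \<Rightarrow> ennreal" where
  "w_full a = (INF P \<in> strategies. expected_step a P)"

text \<open>Block \<open>m \<ge> 1\<close> occupies the steps \<open>2m - 1\<close> and \<open>2m\<close>. The block distribution must be a measure
  whose space is exactly these three pairs (rather than a \<open>pmf\<close>, whose space is the whole type), so
  that the map from block sequences into \<^const>\<open>path_space\<close> is measurable.\<close>

definition aw_block :: "(int \<times> int) measure" where
  "aw_block = uniform_count_measure {(0, 0), (1, 2), (2, 1)}"

definition path_of_blocks :: "(nat \<Rightarrow> int \<times> int) \<Rightarrow> nat \<Rightarrow> int" where
  "path_of_blocks b = (\<lambda>t\<in>{1..}. if odd t then fst (b ((t + 1) div 2)) else snd (b (t div 2)))"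

definition anderson_weber :: "(nat \<Rightarrow> int) measure" where
  "anderson_weber = distr (PiM {1..} (\<lambda>_. aw_block)) path_space path_of_blocks"

end

theory Submission
  imports Defs
begin

text \<open>Write \<open>z t = i t - j t\<close> for the difference of two independent paths. Given the displacement \<open>d\<close>,
  the players meet at the first step with \<open>z t \<equiv> d\<close>, so \<open>E[min {T, k + 1}]\<close> is the expectation of a
  fixed function of \<open>z\<close>, the average over \<open>d \<in> {1, 2}\<close> of the truncated first hitting times
  \<open>delay d k\<close>. This is a quadratic form in the strategy, but not a convex one, so comparing with a
  critical point proves nothing. What makes the problem tractable is that \<open>z\<close> is a difference of two
  independent copies of the same random sequence: if \<open>F (i, j)\<close> is a sum of products
  \<open>f i * f j\<close>, then \<open>E F\<close> is a sum of squares and hence nonnegative, for every strategy at once.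

  The lower bound therefore follows from a function \<open>minorant k\<close> of \<open>z\<close> that lies below the
  averaged hitting time (\<open>minorant_le_delay\<close>) and differs by such a sum of products from the constant
  \<open>truncated_value k\<close> (\<open>gram_kernel_excess\<close>). In Fourier language on the sequences modulo 3,
  all its nontrivial Fourier coefficients are nonnegative and its mean is \<open>truncated_value k\<close>.
  The minorant is recursive. If \<open>z\<close> vanishes at the first step, nothing has been learned and the same
  problem remains with one step fewer. If it does not, then one of the two displacements leads to an
  immediate meeting and the other one leaves a hitting time for a known residue, which is replaced by
  an explicit function of only the next two differences, \<open>later_bound\<close>. Hence one step of the recursion
  changes only coefficients of characters of three consecutive differences, and positive
  definiteness reduces to the identity \<open>excess_Suc\<close> with positive coefficients on the right.

  The Anderson--Weber strategy attains the bound. In a block in which both players choose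
  independently among \<open>(0, 0)\<close>, \<open>(1, 2)\<close>, \<open>(2, 1)\<close>, they fail to meet exactly if they make the same
  choice: two different choices differ by \<open>(1, 2)\<close> or \<open>(2, 1)\<close> modulo 3 and so hit either
  displacement. Thus the probability of not having met drops by a factor \<open>3\<close> per block and is
  \<open>survival n\<close> after \<open>n\<close> steps, whatever path the first player has drawn, and the sum of
  these probabilities is \<open>truncated_value k\<close>. The untruncated game is the monotone limit.\<close>

section \<open>The survival sequence\<close>

text \<open>The probability that two Anderson--Weber players have not met after \<open>n\<close> steps. The same numbers
  supply all constants of the lower bound; the properties of them used there are the recursion
  over two steps, monotonicity, the bounds 0 and 1, and the linear relation \<open>truncated_value_survival\<close>.\<close>

definition survival :: "nat \<Rightarrow> real" where
  "survival n = (1/3) ^ (n div 2) * (if odd n then 2/3 else 1)"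

definition truncated_value :: "nat \<Rightarrow> real" where
  "truncated_value n = (\<Sum>i\<le>n. survival i)"

lemma survival_simps [simp]:
  "survival 0 = 1" "survival (Suc 0) = 2/3" "survival (Suc (Suc n)) = survival n / 3"
  by (auto simp: survival_def)

lemma survival_nonneg: "survival n \<ge> 0"
  by (simp add: survival_def)

lemma survival_le_1: "survival n \<le> 1"
  by (induction n rule: induct_nat_012) auto

lemma survival_Suc_le: "survival (Suc n) \<le> survival n"
  by (induction n rule: induct_nat_012) auto

text \<open>The recursion \<open>survival n = 3 * survival (n + 2)\<close> makes the partial sums linear in two consecutive
  terms. Both conditions that fix the constants of the minorant (its mean, and the Fourier
  coefficient at its first difference) are instances of this relation.\<close>

lemma truncated_value_survival:
  "truncated_value n = 5/2 - survival n / 2 - 3/2 * survival (Suc n)"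
  by (induction n) (simp_all add: truncated_value_def)

lemma truncated_value_Suc: "truncated_value (Suc n) = truncated_value n + survival (Suc n)"
  by (simp add: truncated_value_def)

lemma truncated_value_closed:
  "truncated_value k = (if odd k then 5/2 - 5/2 * 3 powr (- ((real k + 1) / 2))
                        else 5/2 - 3/2 * 3 powr (- (real k / 2)))"
proof -
  have pw: "3 powr (- real m) = (1/3) ^ m" for m
    by (simp add: powr_minus powr_realpow power_one_over field_simps)
  show ?thesis
  proof (cases "even k")
    case True
    then obtain m where k: "k = 2 * m" by (auto elim: evenE)
    have "(- (real k / 2)) = - real m" by (simp add: k)
    then show ?thesis
      using True by (simp only: pw) (simp add: truncated_value_survival survival_def k)
  next
    case False
    then obtain m where k: "k = 2 * m + 1" by (auto elim: oddE)
    have "(- ((real k + 1) / 2)) = - real (Suc m)" by (simp add: k field_simps)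
    then show ?thesis
      using False by (simp only: pw) (simp add: truncated_value_survival survival_def k)
  qed
qed

lemma truncated_value_tendsto: "truncated_value \<longlonglongrightarrow> 5/2"
proof -
  have bound: "survival n \<le> 2 * (1/3 :: real) ^ (n div 2)" for n
    by (simp add: survival_def)
  have "filterlim (\<lambda>n::nat. n div 2) at_top sequentially"
    unfolding filterlim_at_top eventually_sequentially
    by (metis div_le_mono nonzero_mult_div_cancel_left zero_neq_numeral)
  then have "(\<lambda>n. (1/3 :: real) ^ (n div 2)) \<longlonglongrightarrow> 0"
    by (rule filterlim_compose[rotated]) (simp add: LIMSEQ_power_zero)
  then have "(\<lambda>n. 2 * (1/3 :: real) ^ (n div 2)) \<longlonglongrightarrow> 0"
    by (rule tendsto_mult_right_zero)
  then have surv: "survival \<longlonglongrightarrow> 0"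
    by (rule tendsto_sandwich[rotated 3, where f = "\<lambda>_. 0"])
       (auto simp: survival_nonneg bound)
  have "(\<lambda>n. 5/2 - survival n / 2 - 3/2 * survival (Suc n)) \<longlonglongrightarrow> 5/2 - 0 / 2 - 3/2 * 0"
    by (intro tendsto_intros surv LIMSEQ_Suc[OF surv]) auto
  then show ?thesis
    by (simp add: truncated_value_survival[abs_def])
qed

section \<open>A minorant of the truncated meeting step\<close>

text \<open>The first hitting time of the residue \<open>d\<close>, counted from step \<open>\<tau>\<close> on (a hit at \<open>\<tau>\<close> counts 1) and
  capped at \<open>n + 1\<close>. The start \<open>\<tau>\<close> is a parameter so that the recursion never has to shift the
  sequence: every kernel below stays a function of coordinates of the original paths.\<close>

primrec delay :: "int \<Rightarrow> nat \<Rightarrow> nat \<Rightarrow> (nat \<Rightarrow> int) \<Rightarrow> real" where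
  "delay d 0 \<tau> z = 1"
| "delay d (Suc n) \<tau> z = 1 + (if z \<tau> mod 3 = d then 0 else delay d n (Suc \<tau>) z)"

lemma delay_ge_1: "delay d n \<tau> z \<ge> 1"
  by (induction n arbitrary: \<tau>) (auto intro: add_increasing2 order_trans[OF zero_le_one])

lemma sum_no_hit_eq_delay:
  "(\<Sum>i\<le>n. of_bool (\<forall>t\<in>{\<tau>..<\<tau> + i}. z t mod 3 \<noteq> d)) = delay d n \<tau> z"
proof (induction n arbitrary: \<tau>)
  case (Suc n)
  have "(\<forall>t\<in>{\<tau>..<\<tau> + Suc i}. z t mod 3 \<noteq> d) \<longleftrightarrow>
        z \<tau> mod 3 \<noteq> d \<and> (\<forall>t\<in>{Suc \<tau>..<Suc \<tau> + i}. z t mod 3 \<noteq> d)" for i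
    by (metis Suc_le_eq add_Suc add_Suc_right atLeastLessThan_iff le_eq_less_or_eq less_add_Suc1)
  then have "(\<Sum>i\<le>Suc n. of_bool (\<forall>t\<in>{\<tau>..<\<tau> + i}. z t mod 3 \<noteq> d)) =
     1 + (\<Sum>i\<le>n. of_bool (z \<tau> mod 3 \<noteq> d) * of_bool (\<forall>t\<in>{Suc \<tau>..<Suc \<tau> + i}. z t mod 3 \<noteq> d) :: real)"
    by (simp only: sum.atMost_Suc_shift of_bool_conj) simp
  then show ?case
    by (simp only: sum_distrib_left[symmetric] Suc.IH) simp
qed simp

text \<open>A substitute for \<open>delay 2 n\<close> that looks only at the next two differences. It is exact if the first of
  them is \<open>2\<close>. Otherwise it oscillates around \<open>1 + 3/2 * (1 - survival n)\<close> according to the second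
  difference; as \<open>n\<close> grows, its values tend to \<open>2\<close>, \<open>5/2\<close> and \<open>3\<close>. A second difference of \<open>2\<close> means a
  hit after two steps, which caps the value at \<open>2\<close>; the loss is made up, symmetrically in the
  two residues other than \<open>2\<close>, where the two differences agree. The amplitude has index \<open>n - 1\<close>
  because it must be paid for by Fourier coefficients that the minorant received one step earlier.
  For \<open>n \<le> 1\<close> the amplitude is 0 (if \<open>n = 0\<close>, by truncated subtraction), as it should be: no second
  step is left to be looked at.\<close>

definition later_bound :: "nat \<Rightarrow> int \<Rightarrow> int \<Rightarrow> real" where
  "later_bound n x y = 1 + (if x mod 3 = 2 then 0 else
     3/2 * (1 - survival n) + (1 - survival (n - 1)) / 2 *
       (if y mod 3 = 2 then -1 else if x mod 3 = y mod 3 then 1 else 0))"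

text \<open>If the first difference is \<open>1\<close>, then the displacement \<open>1\<close> contributes a meeting now and the displacement
  \<open>2\<close> a further wait, so that the average is \<open>1\<close> plus half of that wait. A first difference of \<open>2\<close> is
  the same situation with the players exchanged, which negates all differences.\<close>

primrec minorant :: "nat \<Rightarrow> nat \<Rightarrow> (nat \<Rightarrow> int) \<Rightarrow> real" where
  "minorant 0 \<tau> z = 1"
| "minorant (Suc n) \<tau> z = 1 +
     (if z \<tau> mod 3 = 0 then minorant n (Suc \<tau>) z
      else if z \<tau> mod 3 = 1 then later_bound n (z (Suc \<tau>)) (z (Suc (Suc \<tau>))) / 2
      else later_bound n (- z (Suc \<tau>)) (- z (Suc (Suc \<tau>))) / 2)"

text \<open>For \<open>n \<ge> 2\<close> the delay is at least \<open>1\<close>, \<open>2\<close> or \<open>3\<close>, according to whether the first hit is at the first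
  step, the second step, or later. The binding case is a hit at the second step; it needs
  \<open>survival (n - 1) \<le> survival (n - 2) = 3 * survival n\<close>.\<close>

lemma later_bound_le_delay: "later_bound n (z \<tau>) (z (Suc \<tau>)) \<le> delay 2 n \<tau> z"
proof -
  consider "n = 0" | "n = 1" | m where "n = Suc (Suc m)"
    by (metis One_nat_def not0_implies_Suc)
  then show ?thesis
  proof cases
    case (3 m)
    define A B where "A = 3/2 * (1 - survival n)" and "B = (1 - survival (n - 1)) / 2"
    have "A + B \<le> 2" "A \<le> 2" "A - B \<le> 1"
      using survival_nonneg[of m] survival_nonneg[of "Suc m"] survival_Suc_le[of m]
      by (simp_all add: A_def B_def 3 field_simps)
    then have "later_bound n (z \<tau>) (z (Suc \<tau>)) \<le>
        1 + (if z \<tau> mod 3 = 2 then 0 else 1 + (if z (Suc \<tau>) mod 3 = 2 then 0 else 1))"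
      unfolding later_bound_def A_def[symmetric] B_def[symmetric] by (simp split: if_split)
    also have "\<dots> \<le> delay 2 n \<tau> z"
      using delay_ge_1[of 2 m "Suc (Suc \<tau>)" z] by (simp add: 3)
    finally show ?thesis .
  qed (auto simp: later_bound_def)
qed

lemma delay_uminus: "delay 2 n \<tau> (\<lambda>t. - z t) = delay 1 n \<tau> z"
proof (induction n arbitrary: \<tau>)
  case (Suc n)
  have "(- z \<tau>) mod 3 = 2 \<longleftrightarrow> z \<tau> mod 3 = 1" by presburger
  with Suc show ?case by simp
qed simp

lemma minorant_le_delay: "minorant n \<tau> z \<le> (delay 1 n \<tau> z + delay 2 n \<tau> z) / 2"
proof (induction n arbitrary: \<tau>)
  case (Suc n)
  have "z \<tau> mod 3 = 0 \<or> z \<tau> mod 3 = 1 \<or> z \<tau> mod 3 = 2" by presburger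
  then show ?case
    using Suc[of "Suc \<tau>"] later_bound_le_delay[of n z "Suc \<tau>"]
      later_bound_le_delay[of n "\<lambda>t. - z t" "Suc \<tau>"]
    by (auto simp: delay_uminus)
qed simp

section \<open>Positive definiteness of the minorant\<close>

text \<open>Finite sums of products \<open>f x * f y\<close>. Positive definiteness in this explicit form survives
  multiplication by another such product, and boundedness and measurability of the factors make the
  double integral a sum of squares without any reduction to a finite set of paths.\<close>

inductive gram_kernel :: "'a measure \<Rightarrow> ('a \<Rightarrow> 'a \<Rightarrow> real) \<Rightarrow> bool" for M where
  zero: "gram_kernel M (\<lambda>_ _. 0)"
| add_square: "gram_kernel M F \<Longrightarrow> f \<in> borel_measurable M \<Longrightarrow> (\<And>x. \<bar>f x\<bar> \<le> B) \<Longrightarrow>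
     gram_kernel M (\<lambda>x y. F x y + f x * f y)"

lemma gram_kernel_square:
  "f \<in> borel_measurable M \<Longrightarrow> (\<And>x. \<bar>f x\<bar> \<le> B) \<Longrightarrow> gram_kernel M (\<lambda>x y. f x * f y)"
  using gram_kernel.add_square[OF gram_kernel.zero, of f M B] by simp

lemma gram_kernel_add:
  assumes "gram_kernel M F" "gram_kernel M G"
  shows "gram_kernel M (\<lambda>x y. F x y + G x y)"
  using assms(2)
proof induction
  case zero
  then show ?case using assms(1) by simp
next
  case (add_square G f B)
  then show ?case
    using gram_kernel.add_square[of M "\<lambda>x y. F x y + G x y" f B] by (simp add: add.assoc)
qed

lemma gram_kernel_mult:
  assumes "gram_kernel M F" and g: "g \<in> borel_measurable M" "\<And>x. \<bar>g x\<bar> \<le> C"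
  shows "gram_kernel M (\<lambda>x y. g x * g y * F x y)"
  using assms(1)
proof induction
  case zero
  then show ?case using gram_kernel.zero by simp
next
  case (add_square F f B)
  have "gram_kernel M (\<lambda>x y. g x * g y * F x y + (g x * f x) * (g y * f y))"
  proof (rule gram_kernel.add_square)
    show "\<bar>g x * f x\<bar> \<le> C * B" for x
      unfolding abs_mult
      using g(2)[of x] add_square.hyps(3)[of x] by (intro mult_mono) auto
  qed (use add_square g in auto)
  then show ?case by (simp add: algebra_simps)
qed

lemma gram_kernel_scale:
  assumes "gram_kernel M F" "c \<ge> 0"
  shows "gram_kernel M (\<lambda>x y. c * F x y)"
  using gram_kernel_mult[OF assms(1), of "\<lambda>_. sqrt c" "sqrt c"] assms(2) by simp

lemma gram_kernel_integral:
  assumes "prob_space M" "gram_kernel M F"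
  shows "integrable (M \<Otimes>\<^sub>M M) (\<lambda>(x, y). F x y)" (is ?int)
    and "(\<integral>(x, y). F x y \<partial>(M \<Otimes>\<^sub>M M)) \<ge> 0" (is ?nonneg)
proof -
  interpret prob_space M by fact
  interpret pair_prob_space M M ..
  from assms(2) have "?int \<and> ?nonneg"
  proof induction
    case (add_square F f B)
    note [measurable] = add_square.hyps(2)
    have int_f: "integrable (M \<Otimes>\<^sub>M M) (\<lambda>(x, y). f x * f y)"
    proof (rule P.integrable_const_bound[where B = "B * B"])
      show "AE p in M \<Otimes>\<^sub>M M. norm (case p of (x, y) \<Rightarrow> f x * f y) \<le> B * B"
        by (rule AE_I2)
           (auto simp: abs_mult intro!: mult_mono add_square.hyps(3) order_trans[OF abs_ge_zero])
    qed measurable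
    have "(\<integral>(x, y). f x * f y \<partial>(M \<Otimes>\<^sub>M M)) = (\<integral>x. (\<integral>y. f x * f y \<partial>M) \<partial>M)"
      using integral_fst'[OF int_f] by simp
    also have "\<dots> = (\<integral>x. f x \<partial>M) * (\<integral>y. f y \<partial>M)" by simp
    finally have "(\<integral>(x, y). f x * f y \<partial>(M \<Otimes>\<^sub>M M)) \<ge> 0" by simp
    with int_f add_square.IH show ?case
      by (auto simp: case_prod_unfold)
  qed simp
  then show ?int ?nonneg by auto
qed

text \<open>With \<open>\<omega> = exp (2 * pi * \<i> / 3)\<close> this is \<open>\<omega> ^ x + \<omega> ^ (- x)\<close>, so \<open>residue_kernel\<close> of an integer
  combination of differences is the real form of a character of the sequences modulo 3.\<close>

definition residue_kernel :: "int \<Rightarrow> real" where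
  "residue_kernel x = (if x mod 3 = 0 then 2 else -1)"

text \<open>The three vectors \<open>3 e\<^sub>r - (1, 1, 1)\<close> in the plane orthogonal to \<open>(1, 1, 1)\<close> have Gram matrix
  proportional to the kernel.\<close>

lemma gram_kernel_residue:
  assumes [measurable]: "\<phi> \<in> M \<rightarrow>\<^sub>M count_space UNIV"
  shows "gram_kernel M (\<lambda>x y. residue_kernel (\<phi> x - \<phi> y))"
proof -
  define f where "f r x = (3 * of_bool (\<phi> x mod 3 = r) - 1 :: real)" for r x
  have [measurable]: "f r \<in> borel_measurable M" for r
    unfolding f_def by measurable
  have "\<bar>f r x\<bar> \<le> 2" for r x by (simp add: f_def)
  then have g: "gram_kernel M (\<lambda>x y. f r x * f r y)" for r
    by (intro gram_kernel_square) auto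
  have eq: "residue_kernel (\<phi> x - \<phi> y) =
      1/3 * (f 0 x * f 0 y + (f 1 x * f 1 y + f 2 x * f 2 y))" for x y
  proof -
    have "\<phi> x mod 3 = 0 \<or> \<phi> x mod 3 = 1 \<or> \<phi> x mod 3 = 2"
         "\<phi> y mod 3 = 0 \<or> \<phi> y mod 3 = 1 \<or> \<phi> y mod 3 = 2" by presburger+
    moreover have "(\<phi> x - \<phi> y) mod 3 = 0 \<longleftrightarrow> \<phi> x mod 3 = \<phi> y mod 3"
      by (simp add: mod_eq_dvd_iff dvd_eq_mod_eq_0)
    ultimately show ?thesis
      by (auto simp: f_def residue_kernel_def)
  qed
  show ?thesis
    unfolding eq
    by (rule gram_kernel_scale[OF gram_kernel_add[OF g gram_kernel_add[OF g g]]]) simp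
qed

text \<open>Multiplication by the indicator of agreement is a block decomposition: the indicator is the sum over
  the residues \<open>r\<close> of the products of the indicators that each of the two arguments has residue \<open>r\<close>.\<close>

lemma gram_kernel_same_residue:
  assumes [measurable]: "\<phi> \<in> M \<rightarrow>\<^sub>M count_space UNIV" and F: "gram_kernel M F"
  shows "gram_kernel M (\<lambda>x y. of_bool ((\<phi> x - \<phi> y) mod (3::int) = 0) * F x y)"
proof -
  define f where "f r x = (of_bool (\<phi> x mod 3 = r) :: real)" for r x
  have [measurable]: "f r \<in> borel_measurable M" for r
    unfolding f_def by measurable
  have "\<bar>f r x\<bar> \<le> 1" for r x by (simp add: f_def)
  then have g: "gram_kernel M (\<lambda>x y. f r x * f r y * F x y)" for r
    by (intro gram_kernel_mult F) auto
  have eq: "of_bool ((\<phi> x - \<phi> y) mod 3 = 0) * F x y =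
      f 0 x * f 0 y * F x y + (f 1 x * f 1 y * F x y + f 2 x * f 2 y * F x y)" for x y
  proof -
    have "\<phi> x mod 3 = 0 \<or> \<phi> x mod 3 = 1 \<or> \<phi> x mod 3 = 2"
         "\<phi> y mod 3 = 0 \<or> \<phi> y mod 3 = 1 \<or> \<phi> y mod 3 = 2" by presburger+
    moreover have "(\<phi> x - \<phi> y) mod 3 = 0 \<longleftrightarrow> \<phi> x mod 3 = \<phi> y mod 3"
      by (simp add: mod_eq_dvd_iff dvd_eq_mod_eq_0)
    ultimately show ?thesis
      by (auto simp: f_def)
  qed
  show ?thesis
    unfolding eq by (rule gram_kernel_add[OF g gram_kernel_add[OF g g]])
qed

text \<open>The part of the minorant that remains when the constant term and all characters of the differences at
  \<open>\<tau>\<close> and \<open>\<tau> + 1\<close> alone are removed; the subtracted terms are exactly these characters with their Fourier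
  coefficients. They are split off because the next step of the recursion has to know them: they
  compensate the negative coefficients of \<open>later_bound\<close>. The character of \<open>z \<tau> + z (\<tau> + 1)\<close> is absent,
  its coefficient being 0. This is forced by tightness, since for a block of the Anderson--Weber
  strategy that starts at \<open>\<tau>\<close> the sum of the two differences is always 0 modulo 3. For \<open>n = 0\<close> the
  truncated subtraction makes the last coefficient 0, and indeed the minorant is then constant.\<close>

definition excess :: "nat \<Rightarrow> nat \<Rightarrow> (nat \<Rightarrow> int) \<Rightarrow> real" where
  "excess n \<tau> z = minorant n \<tau> z - truncated_value n
     - (1 - survival n) / 2 * residue_kernel (z \<tau>)
     - (1 - survival (n - 1)) / 4 *
         (residue_kernel (z (Suc \<tau>)) + residue_kernel (z \<tau> - z (Suc \<tau>)))"

text \<open>The new terms involve only three residues modulo 3, so the identity is a check of 27 cases, each linear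
  in \<open>survival\<close>. The coefficients were found by Fourier inversion: each is a third of the sum of a coefficient
  of \<open>minorant n\<close> and the real part of a coefficient of \<open>later_bound n\<close> rotated by a cube root of unity.
  Those of characters that do not involve \<open>y'\<close> agree with the terms split off in \<open>excess\<close>.\<close>

lemma excess_Suc:
  fixes z :: "nat \<Rightarrow> int" and \<tau> :: nat
  defines "x \<equiv> z \<tau>" and "y \<equiv> z (Suc \<tau>)" and "y' \<equiv> z (Suc (Suc \<tau>))"
  shows "excess (Suc n) \<tau> z = of_bool (x mod 3 = 0) * excess n (Suc \<tau>) z +
     (1 - survival (n - 1)) *
       (1/9 * residue_kernel y' + (1/36 * residue_kernel (x + y') + (1/9 * residue_kernel (2 * x + y')
        + (5/36 * residue_kernel (y + 2 * y') + (1/18 * residue_kernel (x + y + 2 * y')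
        + 1/18 * residue_kernel (2 * x + y + 2 * y'))))))"
proof -
  \<comment> \<open>All kernels are replaced by kernels of residues, so that a case distinction can evaluate them.\<close>
  have mods: "x mod 3 = 0 \<or> x mod 3 = 1 \<or> x mod 3 = 2"
    "y mod 3 = 0 \<or> y mod 3 = 1 \<or> y mod 3 = 2"
    "y' mod 3 = 0 \<or> y' mod 3 = 1 \<or> y' mod 3 = 2" by presburger+
  have red: "residue_kernel (\<alpha> * x + \<beta> * y + \<gamma> * y') =
      residue_kernel (\<alpha> * (x mod 3) + \<beta> * (y mod 3) + \<gamma> * (y' mod 3))" for \<alpha> \<beta> \<gamma>
  proof -
    have "(\<alpha> * x + \<beta> * y + \<gamma> * y') mod 3 =
        (\<alpha> * (x mod 3) + \<beta> * (y mod 3) + \<gamma> * (y' mod 3)) mod 3"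
      by (intro mod_add_cong mod_mult_cong) simp_all
    then show ?thesis by (simp only: residue_kernel_def)
  qed
  have reds:
    "residue_kernel x = residue_kernel (x mod 3)"
    "residue_kernel y = residue_kernel (y mod 3)"
    "residue_kernel y' = residue_kernel (y' mod 3)"
    "residue_kernel (x - y) = residue_kernel (x mod 3 - y mod 3)"
    "residue_kernel (y - y') = residue_kernel (y mod 3 - y' mod 3)"
    "residue_kernel (x + y') = residue_kernel (x mod 3 + y' mod 3)"
    "residue_kernel (2 * x + y') = residue_kernel (2 * (x mod 3) + y' mod 3)"
    "residue_kernel (y + 2 * y') = residue_kernel (y mod 3 + 2 * (y' mod 3))"
    "residue_kernel (x + y + 2 * y') = residue_kernel (x mod 3 + y mod 3 + 2 * (y' mod 3))"
    "residue_kernel (2 * x + y + 2 * y') = residue_kernel (2 * (x mod 3) + y mod 3 + 2 * (y' mod 3))"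
    using red[of 1 0 0] red[of 0 1 0] red[of 0 0 1] red[of 1 "-1" 0] red[of 0 1 "-1"] red[of 1 0 1]
      red[of 2 0 1] red[of 0 1 2] red[of 1 1 2] red[of 2 1 2] by simp_all
  have neg: "(- y) mod 3 = (- (y mod 3)) mod 3" "(- y') mod 3 = (- (y' mod 3)) mod 3"
    by (simp_all add: mod_simps)
  have w: "truncated_value n = 5/2 - survival n / 2 - 3/2 * survival (Suc n)"
    by (rule truncated_value_survival)
  show ?thesis
    unfolding excess_def minorant.simps later_bound_def truncated_value_Suc w
      x_def[symmetric] y_def[symmetric] y'_def[symmetric] reds neg
    using mods by (elim disjE; simp add: residue_kernel_def field_simps)
qed

lemma measurable_count_space_binop:
  fixes g :: "'b \<Rightarrow> 'c::countable"
  assumes "f \<in> M \<rightarrow>\<^sub>M count_space UNIV" "g \<in> M \<rightarrow>\<^sub>M count_space UNIV"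
  shows "(\<lambda>x. h (f x) (g x)) \<in> M \<rightarrow>\<^sub>M count_space UNIV"
proof -
  have "(\<lambda>x. h (f x) k) \<in> M \<rightarrow>\<^sub>M count_space UNIV" for k
    by (rule measurable_compose[OF assms(1)]) simp
  then show ?thesis
    by (rule measurable_compose_countable[OF _ assms(2)])
qed

lemma gram_kernel_excess:
  assumes coord: "\<And>t. t \<ge> \<tau> \<Longrightarrow> (\<lambda>i. i t) \<in> M \<rightarrow>\<^sub>M count_space UNIV"
  shows "gram_kernel M (\<lambda>i j. excess n \<tau> (\<lambda>t. i t - j t))"
  using assms
proof (induction n arbitrary: \<tau>)
  case 0
  then show ?case
    using gram_kernel.zero by (simp add: excess_def truncated_value_def)
next
  case (Suc n)
  note [measurable] = Suc.prems[of \<tau>, simplified] Suc.prems[of "Suc \<tau>", simplified]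
    Suc.prems[of "Suc (Suc \<tau>)", simplified]
  have res: "gram_kernel M (\<lambda>i j. residue_kernel
      (\<alpha> * (i \<tau> - j \<tau>) + \<beta> * (i (Suc \<tau>) - j (Suc \<tau>)) + \<gamma> * (i (Suc (Suc \<tau>)) - j (Suc (Suc \<tau>)))))"
    for \<alpha> \<beta> \<gamma>
  proof -
    let ?\<phi> = "\<lambda>i. \<alpha> * i \<tau> + \<beta> * i (Suc \<tau>) + \<gamma> * i (Suc (Suc \<tau>))"
    have "gram_kernel M (\<lambda>i j. residue_kernel (?\<phi> i - ?\<phi> j))"
    proof (rule gram_kernel_residue)
      show "?\<phi> \<in> M \<rightarrow>\<^sub>M count_space UNIV"
        by (rule measurable_count_space_binop[where h = "\<lambda>u v. u + \<gamma> * v",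
              OF measurable_count_space_binop[where h = "\<lambda>u v. \<alpha> * u + \<beta> * v"]])
           (use Suc.prems in auto)
    qed
    moreover have "\<alpha> * (i \<tau> - j \<tau>) + \<beta> * (i (Suc \<tau>) - j (Suc \<tau>)) +
        \<gamma> * (i (Suc (Suc \<tau>)) - j (Suc (Suc \<tau>))) = ?\<phi> i - ?\<phi> j" for i j
      by (simp add: algebra_simps)
    ultimately show ?thesis by (simp only:)
  qed
  have IH: "gram_kernel M (\<lambda>i j. excess n (Suc \<tau>) (\<lambda>t. i t - j t))"
    using Suc.prems by (intro Suc.IH) auto
  show ?case
    unfolding excess_Suc
    using res[of 0 0 1] res[of 1 0 1] res[of 2 0 1] res[of 0 1 2] res[of 1 1 2] res[of 2 1 2]
      survival_le_1[of "n - 1"]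
    by (intro gram_kernel_add gram_kernel_scale gram_kernel_same_residue IH)
       (simp_all add: algebra_simps)
qed


section \<open>Integration over the game\<close>

lemma nn_integral_displacement:
  "(\<integral>\<^sup>+ d. f d \<partial>uniform_count_measure {1, 2 :: int}) = (f 1 + f 2) / 2"
proof -
  have "ennreal (1/2) = inverse 2"
    using inverse_ennreal[of 2] by (simp add: inverse_eq_divide)
  then show ?thesis
    by (simp add: uniform_count_measure_def nn_integral_point_measure_finite divide_ennreal_def
        distrib_left mult.commute)
qed

lemma prob_space_displacement: "prob_space (uniform_count_measure {1, 2 :: int})"
  by (rule prob_space_uniform_count_measure) auto

lemma strategies_coordinate:
  assumes "P \<in> strategies" "t \<ge> 1"
  shows "(\<lambda>i. i t) \<in> P \<rightarrow>\<^sub>M count_space UNIV"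
proof -
  have "(\<lambda>i. i t) \<in> path_space \<rightarrow>\<^sub>M count_space {0, 1, 2}"
    unfolding path_space_def using assms(2) by (intro measurable_component_singleton) auto
  then have "(\<lambda>i. i t) \<in> path_space \<rightarrow>\<^sub>M count_space UNIV"
    by (rule measurable_compose) simp
  moreover have "sets P = sets path_space"
    using assms(1) by (simp add: strategies_def)
  ultimately show ?thesis
    by (simp cong: measurable_cong_sets)
qed

lemma prob_space_game:
  assumes "P \<in> strategies"
  shows "prob_space (game P)"
proof -
  interpret P: prob_space P using assms by (simp add: strategies_def)
  interpret U: prob_space "uniform_count_measure {1, 2 :: int}" by (rule prob_space_displacement)
  interpret PU: pair_prob_space P "uniform_count_measure {1, 2 :: int}" ..
  interpret PPU: pair_prob_space P "P \<Otimes>\<^sub>M uniform_count_measure {1, 2 :: int}" ..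
  show ?thesis unfolding game_def by (rule PPU.prob_space_axioms)
qed

lemma nn_integral_game:
  assumes "P \<in> strategies" and f: "f \<in> borel_measurable (game P)"
  shows "(\<integral>\<^sup>+ \<omega>. f \<omega> \<partial>game P) = (\<integral>\<^sup>+ i. (\<integral>\<^sup>+ j. (f (i, j, 1) + f (i, j, 2)) / 2 \<partial>P) \<partial>P)"
    and "(\<lambda>i. \<integral>\<^sup>+ j. (f (i, j, 1) + f (i, j, 2)) / 2 \<partial>P) \<in> borel_measurable P"
proof -
  let ?U = "uniform_count_measure {1, 2 :: int}"
  interpret P: prob_space P using assms by (simp add: strategies_def)
  interpret U: prob_space ?U by (rule prob_space_displacement)
  interpret PU: pair_prob_space P ?U ..
  have f': "f \<in> borel_measurable (P \<Otimes>\<^sub>M (P \<Otimes>\<^sub>M ?U))"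
    using f by (simp add: game_def)
  have inner: "(\<integral>\<^sup>+ p. f (i, p) \<partial>(P \<Otimes>\<^sub>M ?U)) = (\<integral>\<^sup>+ j. (f (i, j, 1) + f (i, j, 2)) / 2 \<partial>P)"
    if "i \<in> space P" for i
  proof -
    have "(\<lambda>p. f (i, p)) \<in> borel_measurable (P \<Otimes>\<^sub>M ?U)"
      using f' that by (rule measurable_Pair2)
    from U.nn_integral_fst[OF this, symmetric] show ?thesis
      by (simp add: nn_integral_displacement)
  qed
  show "(\<integral>\<^sup>+ \<omega>. f \<omega> \<partial>game P) = (\<integral>\<^sup>+ i. (\<integral>\<^sup>+ j. (f (i, j, 1) + f (i, j, 2)) / 2 \<partial>P) \<partial>P)"
    unfolding game_def PU.P.nn_integral_fst[OF f', symmetric] by (rule nn_integral_cong) (rule inner)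
  show "(\<lambda>i. \<integral>\<^sup>+ j. (f (i, j, 1) + f (i, j, 2)) / 2 \<partial>P) \<in> borel_measurable P"
    using PU.P.borel_measurable_nn_integral_fst[OF f'] inner by (simp cong: measurable_cong)
qed

lemma meeting_step_gt_iff:
  assumes "d \<in> {1, 2}"
  shows "meeting_step a (i, j, d) > enat n \<longleftrightarrow> (\<forall>t\<in>{1..n}. (i t - j t) mod 3 \<noteq> d)"
proof -
  have "[a + i t = a + d + j t] (mod 3) \<longleftrightarrow> (i t - j t) mod 3 = d" for t
    using assms unfolding cong_def by auto presburger+
  then have "meeting_step a (i, j, d) = (INF t\<in>{t. t \<ge> 1 \<and> (i t - j t) mod 3 = d}. enat t)"
    by (simp add: meeting_step_def)
  also have "\<dots> > enat n \<longleftrightarrow> (\<forall>t\<in>{t. t \<ge> 1 \<and> (i t - j t) mod 3 = d}. enat n < enat t)"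
    unfolding Suc_ile_eq[symmetric] le_INF_iff ..
  finally show ?thesis
    by (auto simp: not_le[symmetric])
qed

text \<open>The layer-cake decomposition behind \<open>E[min {T, k + 1}] = \<Sum>i\<le>k. P(T > i)\<close>.\<close>

lemma truncated_enat_eq_sum:
  "ennreal_of_enat (min x (enat (k + 1))) = (\<Sum>i=0..k. of_bool (x > enat i))"
proof (induction k)
  case 0
  have "ennreal_of_enat (min x (enat 1)) = of_bool (x > enat 0)"
    by (cases x) (auto simp: min_def)
  then show ?case by simp
next
  case (Suc k)
  have "ennreal_of_enat (min x (enat (Suc k + 1))) =
      ennreal_of_enat (min x (enat (k + 1))) + of_bool (x > enat (Suc k))"
  proof (cases x)
    case (enat m)
    then show ?thesis by (cases "m \<le> Suc k") (auto simp: min_def le_Suc_eq add_ac)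
  qed (simp add: add_ac)
  with Suc show ?case by simp
qed

definition late_event :: "int \<Rightarrow> (nat \<Rightarrow> int) measure \<Rightarrow> nat \<Rightarrow> ((nat \<Rightarrow> int) \<times> (nat \<Rightarrow> int) \<times> int) set" where
  "late_event a P n = {\<omega> \<in> space (game P). meeting_step a \<omega> > enat n}"

lemma sets_late_event:
  assumes "P \<in> strategies"
  shows "late_event a P n \<in> sets (game P)"
proof -
  have sp: "\<omega> \<in> space (game P) \<Longrightarrow> snd (snd \<omega>) \<in> {1, 2}" for \<omega>
    by (auto simp: game_def space_pair_measure space_uniform_count_measure)
  have d: "(\<lambda>\<omega>. snd (snd \<omega>)) \<in> game P \<rightarrow>\<^sub>M count_space UNIV"
  proof -
    have "(\<lambda>d. d) \<in> uniform_count_measure {1, 2 :: int} \<rightarrow>\<^sub>M count_space UNIV"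
      by (auto simp: measurable_def space_uniform_count_measure sets_uniform_count_measure)
    then show ?thesis
      unfolding game_def by (rule measurable_compose[rotated]) measurable
  qed
  have hit: "Measurable.pred (game P) (\<lambda>\<omega>. (fst \<omega> t - fst (snd \<omega>) t) mod 3 \<noteq> snd (snd \<omega>))"
    if "t \<ge> 1" for t
  proof -
    have i: "(\<lambda>\<omega>. fst \<omega> t) \<in> game P \<rightarrow>\<^sub>M count_space UNIV"
      unfolding game_def
      by (rule measurable_compose[OF _ strategies_coordinate[OF assms that]]) measurable
    have j: "(\<lambda>\<omega>. fst (snd \<omega>) t) \<in> game P \<rightarrow>\<^sub>M count_space UNIV"
      unfolding game_def
      by (rule measurable_compose[OF _ strategies_coordinate[OF assms that]]) measurable
    show ?thesis
      by (rule measurable_count_space_binop[where h = "\<lambda>u v. u mod 3 \<noteq> v",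
            OF measurable_count_space_binop[where h = "\<lambda>u v. u - v", OF i j] d])
  qed
  have "late_event a P n =
      {\<omega> \<in> space (game P). \<forall>t\<in>{1..n}. (fst \<omega> t - fst (snd \<omega>) t) mod 3 \<noteq> snd (snd \<omega>)}"
    unfolding late_event_def using sp meeting_step_gt_iff[of _ n a]
    by (intro Collect_cong conj_cong refl) (metis prod.collapse)
  also have "\<dots> \<in> sets (game P)"
    using hit by (intro sets.sets_Collect_finite_All) (auto simp: pred_def)
  finally show ?thesis .
qed

lemma sets_unmet:
  assumes "P \<in> strategies"
  shows "{j \<in> space P. \<forall>t\<in>{1..n}. (u t - j t) mod 3 \<noteq> d} \<in> sets P"
proof (rule sets.sets_Collect_finite_All)
  fix t :: nat assume "t \<in> {1..n}"
  then have "(\<lambda>j. j t) \<in> P \<rightarrow>\<^sub>M count_space UNIV"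
    using strategies_coordinate[OF assms] by simp
  then have "(\<lambda>j. (u t - j t) mod 3 \<noteq> d) \<in> P \<rightarrow>\<^sub>M count_space UNIV"
    by (rule measurable_compose) simp
  then show "{j \<in> space P. (u t - j t) mod 3 \<noteq> d} \<in> sets P"
    by (simp add: pred_def)
qed simp

lemma expected_truncated_step_eq:
  assumes "P \<in> strategies"
  shows "expected_truncated_step a k P = (\<Sum>i=0..k. emeasure (game P) (late_event a P i))"
proof -
  have "expected_truncated_step a k P =
      (\<integral>\<^sup>+ \<omega>. (\<Sum>i=0..k. indicator (late_event a P i) \<omega>) \<partial>game P)"
    unfolding expected_truncated_step_def truncated_enat_eq_sum
    by (intro nn_integral_cong sum.cong refl) (simp add: late_event_def indicator_def)
  also have "\<dots> = (\<Sum>i=0..k. emeasure (game P) (late_event a P i))"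
    using sets_late_event[OF assms] by (simp add: nn_integral_sum)
  finally show ?thesis .
qed

lemma expected_truncated_step_delay:
  assumes "P \<in> strategies"
  shows "expected_truncated_step a k P =
    (\<integral>\<^sup>+ (i, j). ennreal ((delay 1 k 1 (\<lambda>t. i t - j t) + delay 2 k 1 (\<lambda>t. i t - j t)) / 2) \<partial>(P \<Otimes>\<^sub>M P))"
proof -
  let ?U = "uniform_count_measure {1, 2 :: int}"
  interpret P: prob_space P using assms by (simp add: strategies_def)
  let ?f = "\<lambda>\<omega>. \<Sum>n\<le>k. indicator (late_event a P n) \<omega> :: ennreal"
  have f: "?f \<in> borel_measurable (game P)"
    using sets_late_event[OF assms] by measurable
  have f_delay: "?f (i, j, d) = ennreal (delay d k 1 (\<lambda>t. i t - j t))"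
    if "i \<in> space P" "j \<in> space P" "d \<in> {1, 2}" for i j d
  proof -
    have "(indicator (late_event a P n) (i, j, d) :: ennreal) =
        ennreal (of_bool (\<forall>t\<in>{1..<1 + n}. (i t - j t) mod 3 \<noteq> d))" for n
      using that meeting_step_gt_iff[OF that(3), of n a i j]
      by (auto simp: late_event_def game_def space_pair_measure space_uniform_count_measure
          indicator_def atLeastLessThanSuc_atLeastAtMost)
    then have "?f (i, j, d) = (\<Sum>n\<le>k. ennreal (of_bool (\<forall>t\<in>{1..<1 + n}. (i t - j t) mod 3 \<noteq> d)))"
      by simp
    also have "\<dots> = ennreal (\<Sum>n\<le>k. of_bool (\<forall>t\<in>{1..<1 + n}. (i t - j t) mod 3 \<noteq> d))"
      by (rule sum_ennreal) auto
    finally show ?thesis by (simp only: sum_no_hit_eq_delay)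
  qed
  have "(\<lambda>p. (fst p, snd p, d)) \<in> P \<Otimes>\<^sub>M P \<rightarrow>\<^sub>M game P" if "d \<in> {1, 2}" for d
    unfolding game_def using that
    by (intro measurable_Pair measurable_fst measurable_snd measurable_const)
       (auto simp: space_uniform_count_measure)
  note meas = measurable_compose[OF this f]
  have "expected_truncated_step a k P = (\<integral>\<^sup>+ \<omega>. ?f \<omega> \<partial>game P)"
    unfolding expected_truncated_step_eq[OF assms] using sets_late_event[OF assms]
    by (simp add: nn_integral_sum atLeast0AtMost)
  also have "\<dots> = (\<integral>\<^sup>+ i. (\<integral>\<^sup>+ j. (?f (i, j, 1) + ?f (i, j, 2)) / 2 \<partial>P) \<partial>P)"
    by (rule nn_integral_game(1)[OF assms f])
  also have "\<dots> = (\<integral>\<^sup>+ p. (?f (fst p, snd p, 1) + ?f (fst p, snd p, 2)) / 2 \<partial>(P \<Otimes>\<^sub>M P))"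
    using P.nn_integral_fst[of "\<lambda>p. (?f (fst p, snd p, 1) + ?f (fst p, snd p, 2)) / 2" P]
      meas[of 1] meas[of 2] by simp
  also have "\<dots> = (\<integral>\<^sup>+ (i, j). ennreal ((delay 1 k 1 (\<lambda>t. i t - j t) + delay 2 k 1 (\<lambda>t. i t - j t)) / 2) \<partial>(P \<Otimes>\<^sub>M P))"
  proof (rule nn_integral_cong)
    fix p assume "p \<in> space (P \<Otimes>\<^sub>M P)"
    moreover have "(ennreal (delay 1 k 1 z) + ennreal (delay 2 k 1 z)) / 2 =
        ennreal ((delay 1 k 1 z + delay 2 k 1 z) / 2)" for z
      using delay_ge_1[of 1 k 1 z] delay_ge_1[of 2 k 1 z]
      by (simp add: ennreal_plus[symmetric] ennreal_divide_numeral del: ennreal_plus)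
    ultimately show "(?f (fst p, snd p, 1) + ?f (fst p, snd p, 2)) / 2 = (case p of (i, j) \<Rightarrow>
        ennreal ((delay 1 k 1 (\<lambda>t. i t - j t) + delay 2 k 1 (\<lambda>t. i t - j t)) / 2))"
      by (auto simp: space_pair_measure f_delay)
  qed
  finally show ?thesis .
qed

text \<open>The lower bound for an arbitrary strategy: adding the split-off characters back to \<open>excess\<close>, with their
  nonnegative coefficients, shows that \<open>minorant k\<close> minus the constant is a Gram kernel, so that its
  expectation is at least that constant.\<close>

lemma truncated_value_le_expected:
  assumes "P \<in> strategies"
  shows "ennreal (truncated_value k) \<le> expected_truncated_step a k P"
proof -
  have P: "prob_space P" using assms by (simp add: strategies_def)
  interpret P: prob_space P by fact
  interpret PP: pair_prob_space P P ..
  let ?G = "\<lambda>(i, j). minorant k 1 (\<lambda>t. i t - j t) - truncated_value k"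
  have coord: "(\<lambda>i. i t) \<in> P \<rightarrow>\<^sub>M count_space UNIV" if "t \<ge> 1" for t
    using strategies_coordinate[OF assms that] .
  have res: "gram_kernel P (\<lambda>i j. residue_kernel (i t - j t))" if "t \<ge> 1" for t
    using coord[OF that] by (rule gram_kernel_residue)
  have res': "gram_kernel P (\<lambda>i j. residue_kernel ((i 1 - j 1) - (i 2 - j 2)))"
    using gram_kernel_residue[OF measurable_count_space_binop[where h = "(-)", OF coord[of 1] coord[of 2]]]
    by (simp add: algebra_simps)
  have gram: "gram_kernel P (\<lambda>i j. minorant k 1 (\<lambda>t. i t - j t) - truncated_value k)"
  proof -
    have eq: "minorant k 1 (\<lambda>t. i t - j t) - truncated_value k =
       excess k 1 (\<lambda>t. i t - j t) + ((1 - survival k) / 2 * residue_kernel (i 1 - j 1)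
       + (1 - survival (k - 1)) / 4 *
         (residue_kernel (i 2 - j 2) + residue_kernel ((i 1 - j 1) - (i 2 - j 2))))" for i j
      by (simp add: excess_def numeral_2_eq_2)
    show ?thesis
      unfolding eq
      by (rule gram_kernel_add[OF gram_kernel_excess gram_kernel_add[OF gram_kernel_scale[OF res]
            gram_kernel_scale[OF gram_kernel_add[OF res res']]]])
         (use coord survival_le_1 in auto)
  qed
  note int = gram_kernel_integral[OF P gram]
  let ?h = "\<lambda>(i, j). minorant k 1 (\<lambda>t. i t - j t)"
  have h: "?h = (\<lambda>p. ?G p + truncated_value k)" by auto
  have int_h: "integrable (P \<Otimes>\<^sub>M P) ?h"
    unfolding h using int(1) by simp
  \<comment> \<open>The positive part links the Lebesgue integral with the nonnegative one.\<close>
  have "truncated_value k \<le> (\<integral>p. ?h p \<partial>(P \<Otimes>\<^sub>M P))"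
    unfolding h using int by (simp add: PP.P.prob_space)
  also have "\<dots> \<le> (\<integral>p. max 0 (?h p) \<partial>(P \<Otimes>\<^sub>M P))"
    using int_h by (intro integral_mono) auto
  finally have "ennreal (truncated_value k) \<le> ennreal (\<integral>p. max 0 (?h p) \<partial>(P \<Otimes>\<^sub>M P))"
    by (rule ennreal_leI)
  also have "\<dots> = (\<integral>\<^sup>+ p. ennreal (max 0 (?h p)) \<partial>(P \<Otimes>\<^sub>M P))"
    using int_h by (intro nn_integral_eq_integral[symmetric]) auto
  also have "\<dots> \<le> expected_truncated_step a k P"
    unfolding expected_truncated_step_delay[OF assms]
    by (intro nn_integral_mono) (auto intro!: ennreal_leI minorant_le_delay simp: max_def ennreal_neg
        order_trans[OF minorant_le_delay])
  finally show ?thesis .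
qed


section \<open>The Anderson--Weber strategy\<close>

definition block_values :: "(int \<times> int) set" where
  "block_values = {(0, 0), (1, 2), (2, 1)}"

lemma block_values_props:
  "finite block_values" "card block_values = 3"
  by (auto simp: block_values_def)

lemma space_aw_block: "space aw_block = block_values"
  and sets_aw_block: "sets aw_block = Pow block_values"
  by (simp_all add: aw_block_def block_values_def space_uniform_count_measure
      sets_uniform_count_measure)

lemma prob_space_aw_block: "prob_space aw_block"
  unfolding aw_block_def by (rule prob_space_uniform_count_measure) auto

lemma product_prob_space_aw: "product_prob_space (\<lambda>_ :: nat. aw_block)"
  by (intro product_prob_space.intro product_prob_space_axioms.intro
      product_sigma_finite.intro prob_space_imp_sigma_finite prob_space_aw_block)

lemma measurable_path_of_blocks: "path_of_blocks \<in> PiM {1..} (\<lambda>_. aw_block) \<rightarrow>\<^sub>M path_space"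
  unfolding path_of_blocks_def path_space_def
proof (rule measurable_restrict)
  fix t :: nat assume t: "t \<in> {1..}"
  have c: "(\<lambda>b. b l) \<in> PiM {1..} (\<lambda>_. aw_block) \<rightarrow>\<^sub>M aw_block" if "l \<ge> 1" for l :: nat
    using that by (intro measurable_component_singleton) auto
  have f: "fst \<in> aw_block \<rightarrow>\<^sub>M count_space {0, 1, 2}" "snd \<in> aw_block \<rightarrow>\<^sub>M count_space {0, 1, 2}"
    by (auto simp: measurable_def space_aw_block sets_aw_block block_values_def)
  show "(\<lambda>b. if odd t then fst (b ((t + 1) div 2)) else snd (b (t div 2)))
      \<in> PiM {1..} (\<lambda>_. aw_block) \<rightarrow>\<^sub>M count_space {0, 1, 2}"
  proof (cases "odd t")
    case True
    then have "(t + 1) div 2 \<ge> 1" by presburger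
    from measurable_compose[OF c[OF this] f(1)] show ?thesis using True by simp
  next
    case False
    then have "t div 2 \<ge> 1" using t by (auto elim!: evenE)
    from measurable_compose[OF c[OF this] f(2)] show ?thesis using False by simp
  qed
qed

lemma anderson_weber_strategy: "anderson_weber \<in> strategies"
proof -
  interpret product_prob_space "\<lambda>_. aw_block" "{1::nat ..}" by (rule product_prob_space_aw)
  show ?thesis
    unfolding strategies_def anderson_weber_def
    using prob_space_distr[OF measurable_path_of_blocks] by simp
qed

text \<open>Block \<open>l\<close> covers the steps \<open>2 * l - 1\<close> and \<open>2 * l\<close>; for odd \<open>n\<close> the last block is only half seen.\<close>

lemma all_steps_iff_blocks:
  "(\<forall>t\<in>{1..n}. Q t) \<longleftrightarrow>
     (\<forall>l\<in>{1..(n + 1) div 2}. Q (2 * l - 1) \<and> (2 * l \<le> n \<longrightarrow> Q (2 * l)))" for n :: nat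
proof
  assume R: "\<forall>l\<in>{1..(n + 1) div 2}. Q (2 * l - 1) \<and> (2 * l \<le> n \<longrightarrow> Q (2 * l))"
  show "\<forall>t\<in>{1..n}. Q t"
  proof
    fix t assume t: "t \<in> {1..n}"
    show "Q t"
    proof (cases "even t")
      case True
      then obtain l where "t = 2 * l" by (auto elim: evenE)
      then show ?thesis using R t by auto
    next
      case False
      then obtain l where l: "t = 2 * l + 1" by (auto elim: oddE)
      then have "Suc l \<in> {1..(n + 1) div 2}" using t by auto
      with R have "Q (2 * Suc l - 1)" by blast
      then show ?thesis using l by simp
    qed
  qed
next
  assume L: "\<forall>t\<in>{1..n}. Q t"
  show "\<forall>l\<in>{1..(n + 1) div 2}. Q (2 * l - 1) \<and> (2 * l \<le> n \<longrightarrow> Q (2 * l))"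
  proof
    fix l assume "l \<in> {1..(n + 1) div 2}"
    then have "2 * l - 1 \<in> {1..n}" "2 * l \<le> n \<Longrightarrow> 2 * l \<in> {1..n}" by auto
    with L show "Q (2 * l - 1) \<and> (2 * l \<le> n \<longrightarrow> Q (2 * l))" by blast
  qed
qed

lemma prod_block_survival:
  "(\<Prod>l\<in>{1..(n + 1) div 2}. if 2 * l \<le> n then 1/3 else 2/3) = survival n"
proof (induction n rule: induct_nat_012)
  case (ge2 n)
  define f where "f l = (if 2 * l \<le> Suc (Suc n) then 1/3 else 2/3 :: real)" for l
  have "(\<Prod>l\<in>{1..(Suc (Suc n) + 1) div 2}. f l) = prod f {Suc 0..Suc ((n + 1) div 2)}"
    by simp
  also have "\<dots> = f (Suc 0) * prod f {Suc (Suc 0)..Suc ((n + 1) div 2)}"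
    by (rule prod.atLeast_Suc_atMost) simp
  also have "\<dots> = 1/3 * (\<Prod>l\<in>{Suc 0..(n + 1) div 2}. f (Suc l))"
    unfolding prod.shift_bounds_cl_Suc_ivl by (simp add: f_def)
  also have "\<dots> = survival n / 3" using ge2(1) by (simp add: f_def)
  finally show ?case by (simp add: f_def)
qed auto

text \<open>For each choice of the first player, exactly one of the three choices of the second player avoids the
  displacement \<open>d\<close> throughout the block (the same choice), and exactly two avoid it at the first step.\<close>

lemma emeasure_block_unmet:
  assumes "c \<in> block_values" "d \<in> {1, 2}"
  shows "emeasure aw_block {c' \<in> block_values. (fst c - fst c') mod 3 \<noteq> d \<and>
           (full \<longrightarrow> (snd c - snd c') mod 3 \<noteq> d)} = ennreal (if full then 1/3 else 2/3)"
proof -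
  let ?Q = "\<lambda>c'. (fst c - fst c') mod 3 \<noteq> d \<and> (full \<longrightarrow> (snd c - snd c') mod 3 \<noteq> d)"
  have "card {c' \<in> block_values. ?Q c'} = (\<Sum>c'\<in>block_values. if ?Q c' then 1 else 0)"
    using block_values_props(1) by (simp add: sum.If_cases Int_def)
  also have "\<dots> = (if full then 1 else 2)"
  proof -
    have "c = (0, 0) \<or> c = (1, 2) \<or> c = (2, 1)" "d = 1 \<or> d = 2"
      using assms by (auto simp: block_values_def)
    then show ?thesis
      by (elim disjE; cases full; simp add: block_values_def)
  qed
  finally have card: "card {c' \<in> block_values. ?Q c'} = (if full then 1 else 2)" .
  have "emeasure aw_block {c' \<in> block_values. ?Q c'} = ennreal (card {c' \<in> block_values. ?Q c'} / card block_values)"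
    unfolding aw_block_def block_values_def[symmetric]
    by (rule emeasure_uniform_count_measure) (auto simp: block_values_props)
  then show ?thesis
    unfolding card block_values_props(2) by simp
qed

text \<open>The path of the first player is kept fixed. Then not having met is a condition on each block of the second player
  separately, so the event is a cylinder set and its probability the product over the blocks. As the
  factors do not depend on the fixed path, no averaging over that path is required.\<close>

lemma emeasure_unmet_anderson_weber:
  assumes b: "b \<in> space (PiM {1..} (\<lambda>_. aw_block))" and d: "d \<in> {1, 2}"
  shows "emeasure anderson_weber
     {j \<in> space anderson_weber. \<forall>t\<in>{1..n}. (path_of_blocks b t - j t) mod 3 \<noteq> d} = ennreal (survival n)"
proof -
  interpret product_prob_space "\<lambda>_. aw_block" "{1::nat ..}" by (rule product_prob_space_aw)
  let ?B = "PiM {1::nat ..} (\<lambda>_. aw_block)"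
  let ?J = "{1..(n + 1) div 2}"
  let ?A = "{j \<in> space anderson_weber. \<forall>t\<in>{1..n}. (path_of_blocks b t - j t) mod 3 \<noteq> d}"
  define X where "X l = {c' \<in> block_values. (fst (b l) - fst c') mod 3 \<noteq> d \<and>
           (2 * l \<le> n \<longrightarrow> (snd (b l) - snd c') mod 3 \<noteq> d)}" for l
  have b_in: "b l \<in> block_values" if "l \<ge> 1" for l
    using b that by (auto simp: space_PiM space_aw_block PiE_iff)
  have odd_step: "path_of_blocks c (2 * l - 1) = fst (c l)" if "l \<ge> 1" for c l
    using that by (cases l) (auto simp: path_of_blocks_def)
  have even_step: "path_of_blocks c (2 * l) = snd (c l)" if "l \<ge> 1" for c l
    using that by (auto simp: path_of_blocks_def)
  have "path_of_blocks -` ?A \<inter> space ?B =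
      {c \<in> space ?B. \<forall>t\<in>{1..n}. (path_of_blocks b t - path_of_blocks c t) mod 3 \<noteq> d}"
    using measurable_space[OF measurable_path_of_blocks]
    by (auto simp: anderson_weber_def)
  also have "\<dots> = {c \<in> space ?B. \<forall>l\<in>?J. c l \<in> X l}"
    unfolding all_steps_iff_blocks[of n]
  proof (intro Collect_cong conj_cong refl ball_cong)
    fix c and l :: nat assume "c \<in> space ?B" "l \<in> ?J"
    then have "l \<ge> 1" "c l \<in> block_values"
      by (auto simp: space_PiM space_aw_block PiE_iff)
    then show "((path_of_blocks b (2 * l - 1) - path_of_blocks c (2 * l - 1)) mod 3 \<noteq> d \<and>
        (2 * l \<le> n \<longrightarrow> (path_of_blocks b (2 * l) - path_of_blocks c (2 * l)) mod 3 \<noteq> d)) = (c l \<in> X l)"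
      by (simp only: odd_step even_step X_def mem_Collect_eq) simp
  qed
  also have "\<dots> = prod_emb {1..} (\<lambda>_. aw_block) ?J (Pi\<^sub>E ?J X)"
    by (auto simp: prod_emb_def space_PiM PiE_iff restrict_def extensional_def)
  finally have pre: "path_of_blocks -` ?A \<inter> space ?B = prod_emb {1..} (\<lambda>_. aw_block) ?J (Pi\<^sub>E ?J X)" .
  have A: "?A \<in> sets path_space"
    using sets_unmet[OF anderson_weber_strategy] by (simp add: anderson_weber_def)
  have "emeasure anderson_weber ?A = emeasure ?B (path_of_blocks -` ?A \<inter> space ?B)"
    unfolding anderson_weber_def
    by (rule emeasure_distr[OF measurable_path_of_blocks A[unfolded anderson_weber_def]])
  also have "\<dots> = (\<Prod>l\<in>?J. emeasure aw_block (X l))"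
    unfolding pre by (rule emeasure_PiM_emb) (auto simp: X_def sets_aw_block)
  also have "\<dots> = (\<Prod>l\<in>?J. ennreal (if 2 * l \<le> n then 1/3 else 2/3))"
    unfolding X_def by (intro prod.cong refl emeasure_block_unmet b_in d) auto
  also have "\<dots> = ennreal (\<Prod>l\<in>?J. if 2 * l \<le> n then 1/3 else 2/3)"
    by (rule prod_ennreal) auto
  finally show ?thesis by (simp only: prod_block_survival)
qed

lemma emeasure_late_event_anderson_weber:
  "emeasure (game anderson_weber) (late_event a anderson_weber n) = ennreal (survival n)"
proof -
  let ?B = "PiM {1::nat ..} (\<lambda>_. aw_block)" and ?W = anderson_weber
  interpret product_prob_space "\<lambda>_. aw_block" "{1::nat ..}" by (rule product_prob_space_aw)
  let ?f = "indicator (late_event a ?W n) :: _ \<Rightarrow> ennreal"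
  have f: "?f \<in> borel_measurable (game ?W)"
    using sets_late_event[OF anderson_weber_strategy] by measurable
  \<comment> \<open>As a function of the first player's path, \<open>g\<close> is constant on the paths that come from blocks.\<close>
  define g where "g i = (\<integral>\<^sup>+ j. (?f (i, j, 1) + ?f (i, j, 2)) / 2 \<partial>?W)" for i
  have g: "g \<in> borel_measurable (distr ?B path_space path_of_blocks)"
    using nn_integral_game(2)[OF anderson_weber_strategy f]
    unfolding g_def by (simp add: anderson_weber_def)
  have inner: "g (path_of_blocks b) = ennreal (survival n)" if b: "b \<in> space ?B" for b
  proof -
    have p: "path_of_blocks b \<in> space ?W"
      using measurable_space[OF measurable_path_of_blocks b] by (simp add: anderson_weber_def)
    define A where "A d = {j \<in> space ?W. \<forall>t\<in>{1..n}. (path_of_blocks b t - j t) mod 3 \<noteq> d}" for d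
    have A: "emeasure ?W (A d) = ennreal (survival n)" if "d \<in> {1, 2}" for d
      unfolding A_def by (rule emeasure_unmet_anderson_weber[OF b that])
    have "A d \<in> sets ?W" for d
      unfolding A_def by (rule sets_unmet[OF anderson_weber_strategy])
    note sets_A = this[of 1] this[of 2]
    have ind: "?f (path_of_blocks b, j, d) = indicator (A d) j"
      if "d \<in> {1, 2}" "j \<in> space ?W" for j d
      using that p meeting_step_gt_iff[OF that(1), of n a "path_of_blocks b" j]
      by (auto simp: late_event_def A_def game_def space_pair_measure space_uniform_count_measure
          indicator_def)
    have "g (path_of_blocks b) = (\<integral>\<^sup>+ j. (indicator (A 1) j + indicator (A 2) j) / 2 \<partial>?W)"
      unfolding g_def by (intro nn_integral_cong) (simp add: ind)
    also have "\<dots> = (emeasure ?W (A 1) + emeasure ?W (A 2)) / 2"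
      using sets_A by (simp add: nn_integral_divide nn_integral_add)
    also have "\<dots> = ennreal (survival n)"
      using survival_nonneg[of n]
      by (simp add: A ennreal_plus[symmetric] ennreal_divide_numeral del: ennreal_plus)
    finally show ?thesis .
  qed
  have "emeasure (game ?W) (late_event a ?W n) = (\<integral>\<^sup>+ \<omega>. ?f \<omega> \<partial>game ?W)"
    using sets_late_event[OF anderson_weber_strategy] by simp
  also have "\<dots> = (\<integral>\<^sup>+ i. g i \<partial>?W)"
    unfolding g_def by (rule nn_integral_game(1)[OF anderson_weber_strategy f])
  also have "\<dots> = (\<integral>\<^sup>+ b. g (path_of_blocks b) \<partial>?B)"
    unfolding anderson_weber_def by (rule nn_integral_distr[OF measurable_path_of_blocks g])
  also have "\<dots> = (\<integral>\<^sup>+ b. ennreal (survival n) \<partial>?B)"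
    by (intro nn_integral_cong inner)
  also have "\<dots> = ennreal (survival n)"
    by (simp only: nn_integral_const P.emeasure_space_1 mult_1_right)
  finally show ?thesis .
qed

lemma expected_truncated_step_anderson_weber:
  "expected_truncated_step a k anderson_weber = ennreal (truncated_value k)"
  unfolding expected_truncated_step_eq[OF anderson_weber_strategy] emeasure_late_event_anderson_weber
    truncated_value_def atLeast0AtMost
  by (rule sum_ennreal) (rule survival_nonneg)

section \<open>The untruncated game\<close>

lemma ennreal_of_enat_eq_SUP: "ennreal_of_enat x = (SUP k. ennreal_of_enat (min x (enat (k + 1))))"
proof (rule antisym)
  show "ennreal_of_enat x \<le> (SUP k. ennreal_of_enat (min x (enat (k + 1))))"
  proof (cases x)
    case (enat m)
    then show ?thesis by (intro SUP_upper2[of m]) (auto simp: min_def)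
  next
    case infinity
    have "(SUP k. of_nat k :: ennreal) \<le> (SUP k. ennreal_of_enat (min x (enat (k + 1))))"
    proof (rule SUP_mono)
      show "\<exists>k'\<in>UNIV. of_nat k \<le> ennreal_of_enat (min x (enat (k' + 1)))" for k :: nat
        by (rule bexI[of _ k]) (simp_all add: infinity)
    qed
    then show ?thesis by (simp add: ennreal_SUP_of_nat_eq_top infinity)
  qed
next
  show "(SUP k. ennreal_of_enat (min x (enat (k + 1)))) \<le> ennreal_of_enat x"
    by (rule SUP_least) simp
qed

lemma expected_step_eq_SUP:
  assumes "P \<in> strategies"
  shows "expected_step a P = (SUP k. expected_truncated_step a k P)"
proof -
  define f where "f k \<omega> = ennreal_of_enat (min (meeting_step a \<omega>) (enat (k + 1)))" for k \<omega>
  have "f k \<in> borel_measurable (game P)" for k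
  proof -
    have "(\<lambda>\<omega>. \<Sum>i=0..k. indicator (late_event a P i) \<omega> :: ennreal) \<in> borel_measurable (game P)"
      using sets_late_event[OF assms] by measurable
    moreover have "f k \<omega> = (\<Sum>i=0..k. indicator (late_event a P i) \<omega>)" if "\<omega> \<in> space (game P)" for \<omega>
      unfolding f_def truncated_enat_eq_sum using that
      by (intro sum.cong refl) (simp add: late_event_def indicator_def)
    ultimately show ?thesis by (simp cong: measurable_cong)
  qed
  moreover have "incseq f"
    by (rule incseq_SucI, rule le_funI) (simp only: f_def truncated_enat_eq_sum, simp)
  ultimately have "(\<integral>\<^sup>+ \<omega>. (SUP k. f k \<omega>) \<partial>game P) = (SUP k. \<integral>\<^sup>+ \<omega>. f k \<omega> \<partial>game P)"
    by (rule nn_integral_monotone_convergence_SUP[rotated])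
  then show ?thesis
    unfolding f_def ennreal_of_enat_eq_SUP[symmetric] expected_step_def expected_truncated_step_def .
qed

lemma SUP_truncated_value: "(SUP k. ennreal (truncated_value k)) = ennreal (5/2)"
proof -
  have "incseq (\<lambda>k. ennreal (truncated_value k))"
    by (intro incseq_SucI ennreal_leI) (simp add: truncated_value_Suc survival_nonneg)
  moreover have "(\<lambda>k. ennreal (truncated_value k)) \<longlonglongrightarrow> ennreal (5/2)"
    by (intro tendsto_ennrealI truncated_value_tendsto)
  ultimately show ?thesis
    by (metis LIMSEQ_SUP LIMSEQ_unique)
qed

lemma INF_eq_attained:
  fixes f :: "'a \<Rightarrow> ennreal"
  assumes "x \<in> S" "\<And>y. y \<in> S \<Longrightarrow> f x \<le> f y"
  shows "(INF y\<in>S. f y) = f x" and "is_arg_min f (\<lambda>y. y \<in> S) x"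
  using assms by (auto simp: is_arg_min_linorder intro!: antisym INF_lower INF_greatest)

theorem theorem1:
  fixes a :: int
  shows "(\<forall>k\<ge>1.
            (\<forall>P\<in>strategies. expected_truncated_step a k P =
               ennreal (\<Sum>i=0..k. \<P>(\<omega> in game P. meeting_step a \<omega> > enat i))) \<and>
            is_arg_min (expected_truncated_step a k) (\<lambda>P. P \<in> strategies) anderson_weber \<and>
            expected_truncated_step a k anderson_weber = w_trunc a k \<and>
            w_trunc a k = ennreal
              (if odd k then 5/2 - 5/2 * 3 powr (- ((real k + 1) / 2))
               else 5/2 - 3/2 * 3 powr (- (real k / 2)))) \<and>
         is_arg_min (expected_step a) (\<lambda>P. P \<in> strategies) anderson_weber \<and>
         expected_step a anderson_weber = w_full a \<and>
         w_full a = ennreal (5/2)"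
proof -
  let ?W = anderson_weber
  have layers: "expected_truncated_step a k P =
      ennreal (\<Sum>i=0..k. \<P>(\<omega> in game P. meeting_step a \<omega> > enat i))" if "P \<in> strategies" for k P
  proof -
    interpret prob_space "game P" by (rule prob_space_game[OF that])
    show ?thesis
      unfolding expected_truncated_step_eq[OF that] emeasure_eq_measure
      by (simp add: sum_ennreal late_event_def)
  qed
  have trunc_least: "expected_truncated_step a k ?W \<le> expected_truncated_step a k P"
    if "P \<in> strategies" for k P
    unfolding expected_truncated_step_anderson_weber by (rule truncated_value_le_expected[OF that])
  have full_least: "expected_step a ?W \<le> expected_step a P" if "P \<in> strategies" for P
    unfolding expected_step_eq_SUP[OF that] expected_step_eq_SUP[OF anderson_weber_strategy]
    by (intro SUP_mono) (use trunc_least[OF that] in auto)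
  have full_value: "expected_step a ?W = ennreal (5/2)"
    unfolding expected_step_eq_SUP[OF anderson_weber_strategy] expected_truncated_step_anderson_weber
    by (rule SUP_truncated_value)
  show ?thesis
    using INF_eq_attained[where f = "expected_truncated_step a _", OF anderson_weber_strategy trunc_least]
      INF_eq_attained[where f = "expected_step a", OF anderson_weber_strategy full_least]
      layers full_value expected_truncated_step_anderson_weber[of a]
    unfolding w_trunc_def w_full_def truncated_value_closed by simp
qed

end
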